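(* Let $m,n$ be integers with $4\le m\le n-3$ (so that $S=\{2,m,n-1\}$ is $n$-admissible), and define $p(\{2,m,n-1\};n)$ by $\#P(\{2,m,n-1\};n)=p(\{2,m,n-1\};n)\,2^{n-4}$. Then $$2p(\{2,m,n-1\};n)=(m-3)(n-m-2)\binom{n-1}{m-1}+(n-1)\Big[(m-3)\binom{n-4}{m-1}+(m-2)\binom{n-4}{m-2}+(n-m-1)\binom{n-4}{m-3}+(n-m-2)\binom{n-4}{m-4}-2\binom{n-4}{1}\Big].$$ Moreover, for fixed $n$, the sequence $p(\{2,m,n-1\};n)$ for $4\le m\le n-3$ is symmetric and unimodal, and attains its maximum only at $m=\lfloor (n+1)/2\rfloor$ and at $m=\lceil (n+1)/2\rceil$.
   Context: For a permutation $\pi=a_1\ldots a_n$ of $\{1,\ldots,n\}$, an index $i$ is a peak if $a_{i-1}<a_i>a_{i+1}$. $P(S;n)$ is the set of permutations of $\{1,\dots,n\}$ whose set of peaks is exactly $S$. *)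

theory Defs
  imports Complex_Main "HOL-Combinatorics.Permutations"
begin

text \<open>A permutation \<open>a\<^sub>1 \<dots> a\<^sub>n\<close> of \<open>{1..n}\<close> is a function with
  \<open>\<pi> permutes {1..n}\<close> and \<open>a\<^sub>i = \<pi> i\<close>. As \<open>\<pi>\<close> is also defined (as the identity) outside
  \<open>{1..n}\<close>, peaks must be restricted explicitly to the indices having both neighbours
  in \<open>{1..n}\<close>.\<close>

definition peak_set :: "nat \<Rightarrow> (nat \<Rightarrow> nat) \<Rightarrow> nat set" where
  "peak_set n \<pi> = {i. 1 < i \<and> i < n \<and> \<pi> (i - 1) < \<pi> i \<and> \<pi> i > \<pi> (i + 1)}"

definition peak_perms :: "nat set \<Rightarrow> nat \<Rightarrow> (nat \<Rightarrow> nat) set" where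
  "peak_perms S n = {\<pi>. \<pi> permutes {1..n} \<and> peak_set n \<pi> = S}"

text \<open>\<open>p({2,m,n-1};n)\<close>, the solution of \<open>#P({2,m,n-1};n) = p({2,m,n-1};n) * 2^(n-4)\<close>. It is
  real-valued, so integrality is not built in.\<close>

definition peak_p :: "nat \<Rightarrow> nat \<Rightarrow> real" where
  "peak_p m n = real (card (peak_perms {2, m, n - 1} n)) / 2 ^ (n - 4)"

definition unimodal_on :: "nat set \<Rightarrow> (nat \<Rightarrow> real) \<Rightarrow> bool" where
  "unimodal_on A f \<longleftrightarrow>
     (\<exists>k\<in>A. (\<forall>i\<in>A. \<forall>j\<in>A. i \<le> j \<and> j \<le> k \<longrightarrow> f i \<le> f j) \<and>
            (\<forall>i\<in>A. \<forall>j\<in>A. k \<le> i \<and> i \<le> j \<longrightarrow> f j \<le> f i))"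

end

theory Submission
  imports Defs "HOL-Combinatorics.Multiset_Permutations"
begin

text \<open>
  Splitting a permutation at its largest entry leaves two arbitrary shorter words, so peak counts
  obey a recursion on the position of the maximum, which is an end of the word or one of the
  prescribed peaks. For \<open>S = {2, m, n - 1}\<close> an end is impossible; the position \<open>m\<close> yields the product
  term, and the positions \<open>2\<close> and \<open>n - 1\<close> yield two mirror-image counts with peak sets of the form
  \<open>{2, l}\<close>, which are evaluated by the same recursion.

  Reversal gives the symmetry. For unimodality, the formula collapses to
  \<open>(n - 2) * 2p = (n - 1 choose (m - 1)) * (2n(m - 1)(n - m) - 4(n - 2)\<^sup>2) - 2(n - 1)(n - 2)(n - 4)\<close>,
  where both factors of the product are positive and increase with \<open>m \<le> (n + 1) / 2\<close>, the first
  one strictly.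
\<close>

section \<open>Peaks of words\<close>

text \<open>Positions start at \<open>1\<close>, as in \<^const>\<open>peak_set\<close>: the entry at position \<open>i\<close> is \<open>xs ! (i - 1)\<close>.\<close>

definition list_peaks :: "'a::linorder list \<Rightarrow> nat set" where
  "list_peaks xs =
     {i. 1 < i \<and> i < length xs \<and> xs ! (i - 2) < xs ! (i - 1) \<and> xs ! i < xs ! (i - 1)}"

definition peak_lists :: "nat set \<Rightarrow> 'a::linorder set \<Rightarrow> 'a list set" where
  "peak_lists S A = {xs \<in> permutations_of_set A. list_peaks xs = S}"

definition peak_count :: "nat set \<Rightarrow> nat \<Rightarrow> nat" where
  "peak_count S n = card (peak_perms S n)"

lemma peak_lists_iff:
  "xs \<in> peak_lists S A \<longleftrightarrow> set xs = A \<and> distinct xs \<and> list_peaks xs = S"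
  by (auto simp: peak_lists_def permutations_of_set_def)

lemma finite_peak_lists [simp]: "finite (peak_lists S A)"
  by (simp add: peak_lists_def)

lemma list_peaks_subset: "list_peaks xs \<subseteq> {1<..<length xs}"
  by (auto simp: list_peaks_def)

lemma list_peaks_map:
  assumes "strict_mono_on (set xs) h"
  shows "list_peaks (map h xs) = list_peaks xs"
  by (auto simp: list_peaks_def strict_mono_on_less[OF assms])

lemma peak_lists_image:
  assumes "strict_mono_on A h"
  shows "peak_lists S (h ` A) = map h ` peak_lists S A"
proof -
  have "inj_on h A"
    using assms by (rule strict_mono_on_imp_inj_on)
  moreover have "list_peaks (map h xs) = list_peaks xs" if "xs \<in> permutations_of_set A" for xs
    using that assms by (intro list_peaks_map) (simp add: permutations_of_setD)
  ultimately show ?thesis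
    by (auto simp: peak_lists_def permutations_of_set_image_inj)
qed

lemma card_peak_lists_image:
  assumes "strict_mono_on A h"
  shows "card (peak_lists S (h ` A)) = card (peak_lists S A)"
proof -
  have "inj_on (map h) (peak_lists S A)"
    using strict_mono_on_imp_inj_on[OF assms]
    by (intro inj_on_mapI) (auto simp: peak_lists_iff intro: inj_on_subset)
  then show ?thesis
    by (simp add: peak_lists_image[OF assms] card_image)
qed

lemma list_peaks_map_upt: "list_peaks (map \<pi> [1..<Suc n]) = peak_set n \<pi>"
proof -
  have nth: "map \<pi> [1..<Suc n] ! i = \<pi> (Suc i)" if "i < n" for i
    using that by (simp del: upt_Suc)
  have "i \<in> list_peaks (map \<pi> [1..<Suc n]) \<longleftrightarrow> i \<in> peak_set n \<pi>" for i
  proof (cases "1 < i \<and> i < n")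
    case True
    then have "Suc (i - 2) = i - 1" "Suc (i - 1) = i"
      by arith+
    with True show ?thesis
      by (simp add: list_peaks_def peak_set_def nth del: upt_Suc)
  qed (auto simp: list_peaks_def peak_set_def simp del: upt_Suc)
  then show ?thesis
    by blast
qed

lemma bij_betw_permutes_permutations_of_set:
  fixes A :: "'a set"
  assumes "set xs = A" "distinct xs"
  shows "bij_betw (\<lambda>\<pi>. map \<pi> xs) {\<pi>. \<pi> permutes A} (permutations_of_set A)"
proof -
  let ?L = "\<lambda>\<pi> :: 'a \<Rightarrow> 'a. map \<pi> xs"
  have "finite A"
    using assms(1) by auto
  have inj: "inj_on ?L {\<pi>. \<pi> permutes A}"
    using assms(1) by (auto simp: inj_on_def fun_eq_iff permutes_def)
  have "?L ` {\<pi>. \<pi> permutes A} = permutations_of_set A"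
  proof (rule card_subset_eq)
    show "?L ` {\<pi>. \<pi> permutes A} \<subseteq> permutations_of_set A"
      using assms by (auto simp: permutations_of_set_def permutes_image distinct_map permutes_inj_on)
    show "card (?L ` {\<pi>. \<pi> permutes A}) = card (permutations_of_set A)"
      using \<open>finite A\<close> by (simp add: card_image[OF inj] card_permutations)
  qed simp
  with inj show ?thesis
    by (simp add: bij_betw_def)
qed

lemma card_peak_lists_atLeastAtMost: "card (peak_lists S {1..n}) = peak_count S n"
proof -
  let ?L = "\<lambda>\<pi>. map \<pi> [1..<Suc n]"
  have bij: "bij_betw ?L {\<pi>. \<pi> permutes {1..n}} (permutations_of_set {1..n})"
    by (intro bij_betw_permutes_permutations_of_set) auto
  have "bij_betw ?L {\<pi> \<in> {\<pi>. \<pi> permutes {1..n}}. peak_set n \<pi> = S} (peak_lists S {1..n})"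
    unfolding peak_lists_def using bij by (rule bij_betw_Collect) (simp only: list_peaks_map_upt)
  then show ?thesis
    by (simp add: peak_count_def peak_perms_def bij_betw_same_card)
qed

lemma card_peak_lists:
  assumes "finite A"
  shows "card (peak_lists S A) = peak_count S (card A)"
proof -
  let ?h = "nth (sorted_list_of_set A)"
  have mono: "strict_mono_on {..<card A} ?h"
    by (auto intro!: strict_mono_onI sorted_wrt_nth_less[OF strict_sorted_list_of_set])
  have "?h ` {..<card A} = A"
    using assms nth_image[of "card A" "sorted_list_of_set A"] by (simp add: lessThan_atLeast0)
  then have "card (peak_lists S A) = card (peak_lists S {..<card A})"
    using card_peak_lists_image[OF mono] by simp
  also have "\<dots> = card (peak_lists S (Suc ` {..<card A}))"
    by (intro card_peak_lists_image[symmetric]) (simp add: strict_mono_on_def)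
  also have "\<dots> = peak_count S (card A)"
    by (simp only: image_Suc_lessThan card_peak_lists_atLeastAtMost)
  finally show ?thesis .
qed

lemma peak_count_eq_0:
  assumes "i \<in> S" "i \<le> 1 \<or> n \<le> i"
  shows "peak_count S n = 0"
proof -
  have "peak_perms S n = {}"
    using assms by (auto simp: peak_perms_def peak_set_def)
  then show ?thesis
    by (simp add: peak_count_def)
qed

lemma peak_count_empty_le_2:
  assumes "n \<le> 2"
  shows "peak_count {} n = fact n"
proof -
  have "peak_perms {} n = {\<pi>. \<pi> permutes {1..n}}"
    using assms by (auto simp: peak_perms_def peak_set_def)
  then show ?thesis
    by (simp add: peak_count_def card_permutations)
qed

section \<open>Reversal\<close>

lemma list_peaks_rev: "list_peaks (rev xs) = (\<lambda>i. Suc (length xs) - i) ` list_peaks xs"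
proof -
  let ?n = "length xs"
  have "i \<in> list_peaks (rev xs) \<longleftrightarrow> Suc ?n - i \<in> list_peaks xs" if "i \<le> ?n" for i
  proof (cases "1 < i \<and> i < ?n")
    case True
    then have "?n - Suc (i - 2) = Suc ?n - i" "?n - Suc (i - 1) = Suc ?n - i - 1"
      "?n - Suc i = Suc ?n - i - 2" by arith+
    with True show ?thesis
      by (auto simp: list_peaks_def rev_nth)
  next
    case False
    with that show ?thesis
      by (auto simp: list_peaks_def)
  qed
  moreover have "1 < i \<and> i \<le> ?n" if "i \<in> list_peaks xs" for i
    using that list_peaks_subset by force
  then have "i \<le> ?n \<and> Suc ?n - i \<in> list_peaks xs \<longleftrightarrow> i \<in> (\<lambda>i. Suc ?n - i) ` list_peaks xs" for i
    by (force simp: image_iff intro!: bexI[of _ "Suc ?n - i"])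
  moreover have "i \<le> ?n" if "i \<in> list_peaks (rev xs)" for i
    using that by (simp add: list_peaks_def)
  ultimately show ?thesis
    by blast
qed

lemma peak_count_reflect:
  assumes "S \<subseteq> {1..n}"
  shows "peak_count ((\<lambda>i. Suc n - i) ` S) n = peak_count S n"
proof -
  let ?r = "\<lambda>i. Suc n - i"
  have length_eq: "length xs = n" if "xs \<in> permutations_of_set {1..n}" for xs :: "nat list"
    using length_finite_permutations_of_set[OF that] by simp
  have "?r ` ?r ` S = S"
    using assms by (force simp: image_image)
  have "bij_betw rev (peak_lists S {1..n}) (peak_lists (?r ` S) {1..n})"
  proof (rule bij_betwI[where g = rev])
    show "rev \<in> peak_lists S {1..n} \<rightarrow> peak_lists (?r ` S) {1..n}"
      using length_eq by (auto simp: peak_lists_def permutations_of_set_def list_peaks_rev)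
    show "rev \<in> peak_lists (?r ` S) {1..n} \<rightarrow> peak_lists S {1..n}"
      using length_eq \<open>?r ` ?r ` S = S\<close>
      by (auto simp: peak_lists_def permutations_of_set_def list_peaks_rev)
  qed auto
  then show ?thesis
    by (metis bij_betw_same_card card_peak_lists_atLeastAtMost)
qed

lemma peak_count_reflect_single:
  assumes "a \<in> {1..n}"
  shows "peak_count {Suc n - a} n = peak_count {a} n"
  using peak_count_reflect[of "{a}" n] assms by simp

lemma peak_count_reflect_pair:
  assumes "a \<in> {1..n}" "b \<in> {1..n}"
  shows "peak_count {Suc n - b, Suc n - a} n = peak_count {a, b} n"
  using peak_count_reflect[of "{a, b}" n] assms by (simp add: insert_commute)

section \<open>The recursion on the position of the maximum\<close>

definition peaks_after :: "nat set \<Rightarrow> nat \<Rightarrow> nat set" where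
  "peaks_after S j = {i. 0 < i \<and> i + j \<in> S}"

definition peak_count_max_at :: "nat set \<Rightarrow> nat \<Rightarrow> nat \<Rightarrow> nat" where
  "peak_count_max_at S n j = (n - 1 choose (j - 1)) *
     (peak_count (S \<inter> {..<j}) (j - 1) * peak_count (peaks_after S j) (n - j))"

lemma peaks_after_empty [simp]: "peaks_after {} j = {}"
  by (simp add: peaks_after_def)

lemma peaks_after_insert [simp]:
  "peaks_after (insert a S) j = (if j < a then insert (a - j) (peaks_after S j) else peaks_after S j)"
  by (auto simp: peaks_after_def)

lemma mem_list_peaks_append_Max_Cons:
  assumes less: "\<forall>x\<in>set xs \<union> set ys. x < M"
  shows "i \<in> list_peaks (xs @ M # ys) \<longleftrightarrow>
    (if i \<le> length xs then i \<in> list_peaks xs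
     else if i = Suc (length xs) then xs \<noteq> [] \<and> ys \<noteq> []
     else i - Suc (length xs) \<in> list_peaks ys)"
proof -
  have xs_less: "xs ! j < M" if "j < length xs" for j
    using less that by simp
  have ys_less: "ys ! j < M" if "j < length ys" for j
    using less that by simp
  consider "i < length xs" | "i = length xs" | "i = Suc (length xs)" | "i = Suc (Suc (length xs))"
    | d where "i = length xs + Suc (Suc (Suc d))"
  proof -
    have "i < length xs \<or> i = length xs \<or> i = Suc (length xs) \<or> i = Suc (Suc (length xs)) \<or>
      i = length xs + Suc (Suc (Suc (i - length xs - 3)))"
      by arith
    with that show thesis
      by blast
  qed
  then show ?thesis
  proof cases
    case 1
    then show ?thesis
      by (auto simp: list_peaks_def nth_append)
  next
    case 2
    then show ?thesis
      using xs_less[of "i - 1"] by (auto simp: list_peaks_def nth_append)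
  next
    case 3
    then have "xs \<noteq> [] \<Longrightarrow> xs ! (i - 2) < M" "ys \<noteq> [] \<Longrightarrow> ys ! 0 < M"
      using xs_less ys_less by simp_all
    with 3 show ?thesis
      by (cases "xs = []"; cases "ys = []") (auto simp: list_peaks_def nth_append)
  next
    case 4
    then show ?thesis
      using ys_less[of 0] by (auto simp: list_peaks_def nth_append dest: less_asym)
  next
    case 5
    then show ?thesis
      by (simp add: list_peaks_def nth_append)
  qed
qed

lemma list_peaks_append_Max_Cons_eq_iff:
  assumes "\<forall>x\<in>set xs \<union> set ys. x < M"
  shows "list_peaks (xs @ M # ys) = S \<longleftrightarrow>
    (Suc (length xs) \<in> S \<longleftrightarrow> xs \<noteq> [] \<and> ys \<noteq> []) \<and>
    list_peaks xs = S \<inter> {..length xs} \<and> list_peaks ys = peaks_after S (Suc (length xs))"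
    (is "?L \<longleftrightarrow> ?R")
proof
  note mem = mem_list_peaks_append_Max_Cons[OF assms]
  show ?R if ?L
    unfolding that[symmetric] using list_peaks_subset[of xs] list_peaks_subset[of ys]
    by (auto simp: mem peaks_after_def subset_iff)
  show ?L if ?R
  proof (rule set_eqI)
    fix i
    have "i - Suc (length xs) \<in> peaks_after S (Suc (length xs)) \<longleftrightarrow> i \<in> S"
      if "Suc (length xs) < i"
      using that by (simp add: peaks_after_def)
    with \<open>?R\<close> show "i \<in> list_peaks (xs @ M # ys) \<longleftrightarrow> i \<in> S"
      by (simp add: mem)
  qed
qed

lemma append_Max_Cons_in_peak_lists_iff:
  assumes less: "\<forall>x\<in>B. x < M"
  shows "xs @ M # ys \<in> peak_lists S (insert M B) \<longleftrightarrow>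
    set xs \<subseteq> B \<and> (Suc (card (set xs)) \<in> S \<longleftrightarrow> set xs \<noteq> {} \<and> set xs \<noteq> B) \<and>
    xs \<in> peak_lists (S \<inter> {..card (set xs)}) (set xs) \<and>
    ys \<in> peak_lists (peaks_after S (Suc (card (set xs)))) (B - set xs)"
proof (cases "set xs \<subseteq> B \<and> set ys = B - set xs \<and> distinct xs \<and> distinct ys")
  case True
  moreover from this have "ys \<noteq> [] \<longleftrightarrow> set xs \<noteq> B"
    by (metis Diff_cancel Diff_eq_empty_iff set_empty subset_antisym)
  moreover have "\<forall>x\<in>set xs \<union> set ys. x < M" "M \<notin> B"
    using True less by auto
  ultimately show ?thesis
    by (auto simp: peak_lists_iff list_peaks_append_Max_Cons_eq_iff distinct_card)
next
  case False
  moreover have "M \<notin> B"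
    using less by blast
  ultimately show ?thesis
    by (auto simp: peak_lists_iff)
qed

text \<open>The sets of entries that may precede the maximum, which is a peak unless it stands at an end.\<close>

definition pre_Max_sets :: "nat set \<Rightarrow> 'a set \<Rightarrow> 'a set set" where
  "pre_Max_sets S B = {C. C \<subseteq> B \<and> (Suc (card C) \<in> S \<longleftrightarrow> C \<noteq> {} \<and> C \<noteq> B)}"

lemma peak_lists_insert_Max:
  assumes "\<forall>x\<in>B. x < M"
  shows "peak_lists S (insert M B) = (\<lambda>(xs, ys). xs @ M # ys) `
    (\<Union>C\<in>pre_Max_sets S B.
      peak_lists (S \<inter> {..card C}) C \<times> peak_lists (peaks_after S (Suc (card C))) (B - C))"
    (is "?L = ?app ` ?P")
proof (rule set_eqI)
  fix zs
  have mem: "xs @ M # ys \<in> ?L \<longleftrightarrow> (xs, ys) \<in> ?P" for xs ys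
    unfolding append_Max_Cons_in_peak_lists_iff[OF assms]
    by (auto simp: pre_Max_sets_def peak_lists_iff)
  have "zs \<in> ?L \<longleftrightarrow> (\<exists>xs ys. zs = xs @ M # ys \<and> zs \<in> ?L)"
    using split_list[of M zs] by (auto simp: peak_lists_iff)
  also have "\<dots> \<longleftrightarrow> (\<exists>xs ys. zs = xs @ M # ys \<and> (xs, ys) \<in> ?P)"
    using mem by blast
  also have "\<dots> \<longleftrightarrow> zs \<in> ?app ` ?P"
    by (simp only: image_iff Bex_def split_paired_Ex prod.case) blast
  finally show "zs \<in> ?L \<longleftrightarrow> zs \<in> ?app ` ?P" .
qed

lemma card_peak_lists_insert_Max:
  assumes "finite B" and less: "\<forall>x\<in>B. x < M"
  shows "card (peak_lists S (insert M B)) =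
    (\<Sum>C\<in>pre_Max_sets S B. peak_count (S \<inter> {..card C}) (card C) *
      peak_count (peaks_after S (Suc (card C))) (card B - card C))"
proof -
  let ?P = "\<lambda>C. peak_lists (S \<inter> {..card C}) C \<times> peak_lists (peaks_after S (Suc (card C))) (B - C)"
  have subset_finite: "C \<subseteq> B" "finite C" if "C \<in> pre_Max_sets S B" for C
    using that assms(1) finite_subset by (auto simp: pre_Max_sets_def)
  have "M \<notin> B" "M \<notin> C" if "C \<in> pre_Max_sets S B" for C
    using less subset_finite[OF that] by auto
  then have "inj_on (\<lambda>(xs, ys). xs @ M # ys) (\<Union>C\<in>pre_Max_sets S B. ?P C)"
    by (intro inj_onI) (auto simp: peak_lists_iff append_Cons_eq_iff)
  then have "card (peak_lists S (insert M B)) = card (\<Union>C\<in>pre_Max_sets S B. ?P C)"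
    by (simp add: peak_lists_insert_Max[OF less] card_image)
  also have "\<dots> = (\<Sum>C\<in>pre_Max_sets S B. card (?P C))"
  proof (rule card_UN_disjoint)
    have "pre_Max_sets S B \<subseteq> Pow B"
      using subset_finite(1) by blast
    then show "finite (pre_Max_sets S B)"
      using assms(1) by (meson finite_Pow_iff finite_subset)
  qed (auto simp: peak_lists_iff)
  also have "\<dots> = (\<Sum>C\<in>pre_Max_sets S B. peak_count (S \<inter> {..card C}) (card C) *
      peak_count (peaks_after S (Suc (card C))) (card B - card C))"
    using assms(1) subset_finite
    by (intro sum.cong) (simp_all add: card_cartesian_product card_peak_lists card_Diff_subset)
  finally show ?thesis .
qed

lemma pre_Max_sets_eq:
  assumes "finite B" "B \<noteq> {}" "S \<subseteq> {1<..card B}"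
  shows "pre_Max_sets S B = {C. C \<subseteq> B \<and> Suc (card C) \<in> insert 1 (insert (Suc (card B)) S)}"
proof -
  have "Suc 0 \<notin> S" "Suc (card B) \<notin> S"
    using assms(3) by auto
  moreover have "C = {} \<longleftrightarrow> card C = 0" "C = B \<longleftrightarrow> card C = card B" if "C \<subseteq> B" for C
    using that assms(1) by (metis card_0_eq finite_subset, metis card_subset_eq)
  moreover have "card B \<noteq> 0"
    using assms by simp
  ultimately have "(Suc (card C) \<in> S \<longleftrightarrow> C \<noteq> {} \<and> C \<noteq> B) \<longleftrightarrow>
      Suc (card C) \<in> insert 1 (insert (Suc (card B)) S)" if "C \<subseteq> B" for C
    using that by (cases "card C = 0"; cases "card C = card B") simp_all
  then show ?thesis
    unfolding pre_Max_sets_def by blast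
qed

lemma sum_subsets_card:
  fixes f :: "nat \<Rightarrow> 'a::semiring_1"
  assumes "finite B" "finite S" "0 \<notin> S"
  shows "(\<Sum>C | C \<subseteq> B \<and> Suc (card C) \<in> S. f (Suc (card C))) =
    (\<Sum>j\<in>S. of_nat (card B choose (j - 1)) * f j)"
proof -
  let ?T = "{C. C \<subseteq> B \<and> Suc (card C) \<in> S}"
  have "finite ?T"
    using assms(1) by simp
  then have "(\<Sum>C\<in>?T. f (Suc (card C))) =
      (\<Sum>j\<in>S. \<Sum>C | C \<in> ?T \<and> Suc (card C) = j. f (Suc (card C)))"
    using assms(2) by (intro sum.group[symmetric]) auto
  also have "\<dots> = (\<Sum>j\<in>S. of_nat (card B choose (j - 1)) * f j)"
  proof (rule sum.cong)
    fix j assume "j \<in> S"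
    then have "{C. C \<in> ?T \<and> Suc (card C) = j} = {C. C \<subseteq> B \<and> card C = j - 1}"
      using assms(3) by (cases j) auto
    then have "card {C. C \<in> ?T \<and> Suc (card C) = j} = card B choose (j - 1)"
      using n_subsets[OF assms(1)] by simp
    then show "(\<Sum>C | C \<in> ?T \<and> Suc (card C) = j. f (Suc (card C))) =
        of_nat (card B choose (j - 1)) * f j"
      by simp
  qed simp
  finally show ?thesis .
qed

lemma peak_count_eq_sum_max_at:
  assumes "2 \<le> n" "S \<subseteq> {1<..<n}"
  shows "peak_count S n = (\<Sum>j\<in>insert 1 (insert n S). peak_count_max_at S n j)"
proof -
  let ?B = "{1..n - 1}"
  let ?f = "\<lambda>j. peak_count (S \<inter> {..<j}) (j - 1) * peak_count (peaks_after S j) (n - j)"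
  have "{1..n} = insert n ?B"
    using assms(1) by auto
  then have "peak_count S n = card (peak_lists S (insert n ?B))"
    by (simp add: card_peak_lists_atLeastAtMost[symmetric])
  also have "\<dots> = (\<Sum>C\<in>pre_Max_sets S ?B. ?f (Suc (card C)))"
    using assms(1) by (subst card_peak_lists_insert_Max) (auto simp: lessThan_Suc_atMost)
  also have "S \<subseteq> {1<..card ?B}"
    using assms(2) by force
  then have "pre_Max_sets S ?B = {C. C \<subseteq> ?B \<and> Suc (card C) \<in> insert 1 (insert n S)}"
    using assms(1) by (subst pre_Max_sets_eq) auto
  also have "(\<Sum>C\<in>\<dots>. ?f (Suc (card C))) =
      (\<Sum>j\<in>insert 1 (insert n S). of_nat (card ?B choose (j - 1)) * ?f j)"
    using assms finite_subset[OF assms(2)] by (intro sum_subsets_card) auto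
  finally show ?thesis
    by (simp add: peak_count_max_at_def)
qed

lemma peak_count_rec:
  assumes "2 \<le> n" "S \<subseteq> {1<..<n}"
  shows "peak_count S n = peak_count (peaks_after S 1) (n - 1) + peak_count S (n - 1) +
    (\<Sum>j\<in>S. peak_count_max_at S n j)"
proof -
  have "finite S" "1 \<notin> S" "n \<notin> S"
    using assms(2) finite_subset by auto
  moreover have "S \<inter> {..<1} = {}" "S \<inter> {..<n} = S" "peaks_after S n = {}"
    using assms(2) by (auto simp: peaks_after_def)
  then have "peak_count_max_at S n 1 = peak_count (peaks_after S 1) (n - 1)"
    "peak_count_max_at S n n = peak_count S (n - 1)"
    by (simp_all add: peak_count_max_at_def peak_count_empty_le_2)
  ultimately show ?thesis
    using assms(1) peak_count_eq_sum_max_at[OF assms] by simp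
qed

section \<open>Small peak sets\<close>

lemma peak_count_empty:
  assumes "0 < n"
  shows "peak_count {} n = 2 ^ (n - 1)"
  using assms
proof (induction n rule: nat_induct_non_zero)
  case 1
  show ?case
    by (simp add: peak_count_empty_le_2)
next
  case (Suc n)
  then show ?case
    using peak_count_rec[of "Suc n" "{}"] by (cases n) simp_all
qed

lemma peak_count_single:
  assumes "2 \<le> n" "a \<in> {1..n}"
  shows "real (peak_count {a} n) = (real (n - 1 choose (a - 1)) - 1) * 2 ^ (n - 2)"
  using assms
proof (induction n arbitrary: a rule: nat_induct_at_least)
  case base
  then have "peak_count {a} 2 = 0" "a = 1 \<or> a = 2"
    by (auto intro!: peak_count_eq_0[of a])
  then show ?case
    by auto
next
  case (Suc n)
  show ?case
  proof (cases "a = 1 \<or> a = Suc n")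
    case True
    then have "peak_count {a} (Suc n) = 0"
      by (intro peak_count_eq_0[of a]) auto
    with True show ?thesis
      by auto
  next
    case False
    then have interior: "1 < a" "a \<le> n"
      using Suc.prems by auto
    have "(2::nat) ^ (a - 2) * 2 ^ (n - a) = 2 ^ (n - 2)"
      using interior by (simp flip: power_add)
    then have rec: "peak_count {a} (Suc n) =
        peak_count {a - 1} n + peak_count {a} n + (n choose (a - 1)) * 2 ^ (n - 2)"
      using interior Suc.hyps
      by (subst peak_count_rec) (auto simp: peak_count_max_at_def peak_count_empty numeral_2_eq_2)
    have "n choose (a - 1) = (n - 1 choose (a - 2)) + (n - 1 choose (a - 1))"
      using interior choose_reduce_nat[of n "a - 1"] by (simp add: numeral_2_eq_2)
    moreover have "a - 1 \<in> {1..n}"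
      using interior by auto
    then have "real (peak_count {a - 1} n) = (real (n - 1 choose (a - 2)) - 1) * 2 ^ (n - 2)"
      using Suc.IH by (simp only: diff_diff_left one_add_one)
    moreover have "(2::real) ^ (Suc n - 2) = 2 * 2 ^ (n - 2)"
      using Suc.hyps by (simp add: Suc_diff_le flip: power_Suc)
    ultimately show ?thesis
      using Suc.IH[of a] interior unfolding rec by (simp add: algebra_simps)
  qed
qed

lemma peak_count_2:
  assumes "2 \<le> n"
  shows "real (peak_count {2} n) = (real n - 2) * 2 ^ (n - 2)"
  using peak_count_single[of n 2] assms by simp

lemma of_nat_Suc_times_binomial:
  "real (Suc k) * real (n choose Suc k) = (real n - real k) * real (n choose k)"
  using gbinomial_mult_1[of "real n" k] by (simp add: binomial_gbinomial algebra_simps)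

lemma binomial_doubling_identity:
  fixes N r :: nat
  shows "real r * real (N choose (r + 2)) + (real r + 1) * real (N choose (r + 1)) - real N +
      (real N + 2) * (real (N choose r) - 1) + real r * real (N + 2 choose (r + 2)) =
    2 * (real r * real (N + 1 choose (r + 2)) + (real r + 1) * real (N + 1 choose (r + 1))
      - real (N + 1))"
  using of_nat_Suc_times_binomial[of r N] by (simp add: numeral_2_eq_2 algebra_simps)

lemma peak_count_2_single_rec:
  assumes "4 \<le> a" "a \<le> n"
  shows "peak_count {2, a} (Suc n) = peak_count {2, a} n + n * peak_count {a - 2} (n - 1) +
    (n choose (a - 1)) * (peak_count {2} (a - 1) * 2 ^ (n - a))"
proof -
  have "{2, a} \<inter> {..<2} = {}" "{2, a} \<inter> {..<a} = {2}"
    using assms by auto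
  moreover have "peak_count {1, a - 1} n = 0"
    by (intro peak_count_eq_0[of 1]) auto
  ultimately show ?thesis
    using assms by (subst peak_count_rec) (auto simp: peak_count_max_at_def peak_count_empty)
qed

lemma peak_count_2_single:
  assumes "4 \<le> a" "a \<le> n"
  shows "real (peak_count {2, a} n) =
    ((real a - 3) * real (n - 2 choose (a - 1)) + (real a - 2) * real (n - 2 choose (a - 2))
      - (real n - 2)) * 2 ^ (n - 3)"
  using assms(2)
proof (induction n rule: nat_induct_at_least)
  case base
  have "peak_count {2, a} a = 0"
    by (intro peak_count_eq_0[of a]) auto
  then show ?case
    using assms(1) by simp
next
  case (Suc n)
  obtain r where a_eq: "a = r + 3"
    using assms(1) by (intro that[of "a - 3"]) auto
  obtain N where n_eq: "n = N + 2"
    using assms(1) Suc.hyps by (intro that[of "n - 2"]) auto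
  define e where "e = (2::real) ^ (n - 3)"
  have "real (peak_count {2, a} n) =
      (real r * real (N choose (r + 2)) + (real r + 1) * real (N choose (r + 1)) - real N) * e"
    using Suc.IH by (simp add: a_eq n_eq e_def algebra_simps)
  moreover have "real (peak_count {a - 2} (n - 1)) = (real (N choose r) - 1) * e"
    using assms(1) Suc.hyps by (subst peak_count_single) (auto simp: a_eq n_eq e_def)
  moreover have "real (peak_count {2} (a - 1)) * 2 ^ (n - a) = real r * e"
    using assms(1) Suc.hyps
    by (subst peak_count_2) (auto simp: a_eq e_def Suc_diff_le simp flip: power_add)
  ultimately have "real (peak_count {2, a} (Suc n)) =
      (real r * real (N choose (r + 2)) + (real r + 1) * real (N choose (r + 1)) - real N) * e +
      real n * ((real (N choose r) - 1) * e) + real (n choose (a - 1)) * (real r * e)"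
    unfolding peak_count_2_single_rec[OF assms(1) Suc.hyps] by simp
  also have "\<dots> = (real r * real (N choose (r + 2)) + (real r + 1) * real (N choose (r + 1)) - real N +
      (real N + 2) * (real (N choose r) - 1) + real r * real (N + 2 choose (r + 2))) * e"
    by (simp add: a_eq n_eq algebra_simps)
  also have "\<dots> = (real r * real (N + 1 choose (r + 2)) + (real r + 1) * real (N + 1 choose (r + 1))
      - real (N + 1)) * (2 * e)"
    unfolding binomial_doubling_identity by simp
  also have "2 * e = 2 ^ (Suc n - 3)"
    using assms(1) Suc.hyps by (simp add: a_eq n_eq e_def flip: power_Suc)
  finally show ?case
    by (simp add: a_eq n_eq)
qed

section \<open>The peak set \<open>{2, m, n - 1}\<close>\<close>

lemma peak_count_2_single_penultimate:
  assumes "4 \<le> m" "m + 3 \<le> n"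
  shows "peak_count {2, m, n - 1} n =
    (n - 1) * peak_count {2, n + 1 - m} (n - 2) +
    (n - 1 choose (m - 1)) * (peak_count {2} (m - 1) * peak_count {2} (n - m)) +
    (n - 1) * peak_count {2, m} (n - 2)"
proof -
  let ?S = "{2, m, n - 1}"
  have before: "?S \<inter> {..<2} = {}" "?S \<inter> {..<m} = {2}" "?S \<inter> {..<n - 1} = {2, m}"
    using assms by auto
  have after: "peaks_after ?S 2 = {m - 2, n - 3}" "peaks_after ?S m = {n - 1 - m}"
    "peaks_after ?S (n - 1) = {}"
    using assms by auto
  have "m - 2 = Suc (n - 2) - (n + 1 - m)" "n - 3 = Suc (n - 2) - 2" "n - 1 - m = Suc (n - m) - 2"
    using assms by arith+
  moreover have "2 \<in> {1..n - 2}" "n + 1 - m \<in> {1..n - 2}" "2 \<in> {1..n - m}"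
    using assms by auto
  ultimately have reflect:
    "peak_count {m - 2, n - 3} (n - 2) = peak_count {2, n + 1 - m} (n - 2)"
    "peak_count {n - 1 - m} (n - m) = peak_count {2} (n - m)"
    using peak_count_reflect_pair peak_count_reflect_single by presburger+
  have "peak_count (peaks_after ?S 1) (n - 1) = 0"
    using assms by (intro peak_count_eq_0[of 1]) auto
  moreover have "peak_count ?S (n - 1) = 0"
    by (intro peak_count_eq_0[of "n - 1"]) auto
  moreover have "2 \<le> n" "?S \<subseteq> {1<..<n}"
    using assms by auto
  ultimately have "peak_count ?S n = (\<Sum>j\<in>?S. peak_count_max_at ?S n j)"
    using peak_count_rec[of n ?S] by (metis add_0)
  also have "\<dots> =
      peak_count_max_at ?S n 2 + peak_count_max_at ?S n m + peak_count_max_at ?S n (n - 1)"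
    using assms by simp
  also have "peak_count_max_at ?S n 2 = (n - 1) * peak_count {2, n + 1 - m} (n - 2)"
    unfolding peak_count_max_at_def before after reflect by (simp add: peak_count_empty_le_2)
  also have "peak_count_max_at ?S n m =
      (n - 1 choose (m - 1)) * (peak_count {2} (m - 1) * peak_count {2} (n - m))"
    unfolding peak_count_max_at_def before after reflect by (rule refl)
  also have "peak_count_max_at ?S n (n - 1) = (n - 1) * peak_count {2, m} (n - 2)"
    unfolding peak_count_max_at_def before after
    using assms binomial_symmetric[of 1 "n - 1"] by (simp add: peak_count_empty_le_2 numeral_2_eq_2)
  finally show ?thesis .
qed

lemma peak_p_symmetric:
  assumes "4 \<le> m" "m + 3 \<le> n"
  shows "peak_p (n + 1 - m) n = peak_p m n"
proof -
  have "(\<lambda>i. Suc n - i) ` {2, m, n - 1} = {2, n + 1 - m, n - 1}"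
    using assms by auto
  moreover have "{2, m, n - 1} \<subseteq> {1..n}"
    using assms by auto
  ultimately have "peak_count {2, n + 1 - m, n - 1} n = peak_count {2, m, n - 1} n"
    using peak_count_reflect by metis
  then show ?thesis
    by (simp add: peak_p_def peak_count_def)
qed

lemma two_peak_p_eq:
  assumes "4 \<le> m" "m + 3 \<le> n"
  shows "2 * peak_p m n =
    (real m - 3) * (real n - real m - 2) * real ((n - 1) choose (m - 1)) +
    (real n - 1) *
      ((real m - 3) * real ((n - 4) choose (m - 1)) +
       (real m - 2) * real ((n - 4) choose (m - 2)) +
       (real n - real m - 1) * real ((n - 4) choose (m - 3)) +
       (real n - real m - 2) * real ((n - 4) choose (m - 4)) -
       2 * real ((n - 4) choose 1))"
    (is "_ = ?rhs")
proof -
  define e where "e = (2::real) ^ (n - 5)"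
  have left: "real (peak_count {2, m} (n - 2)) = ((real m - 3) * real (n - 4 choose (m - 1)) +
      (real m - 2) * real (n - 4 choose (m - 2)) - real (n - 4)) * e"
    using assms by (subst peak_count_2_single) (auto simp: e_def)
  have "n - 4 choose (n - m) = n - 4 choose (m - 4)"
    "n - 4 choose (n - 1 - m) = n - 4 choose (m - 3)"
    using assms binomial_symmetric[of "m - 4" "n - 4"] binomial_symmetric[of "m - 3" "n - 4"]
    by simp_all
  moreover have "4 \<le> n + 1 - m" "n + 1 - m \<le> n - 2"
    using assms by auto
  ultimately have right: "real (peak_count {2, n + 1 - m} (n - 2)) =
      ((real n - real m - 2) * real (n - 4 choose (m - 4)) +
        (real n - real m - 1) * real (n - 4 choose (m - 3)) - real (n - 4)) * e"
    using assms by (subst peak_count_2_single) (auto simp: e_def)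
  have "(m - 1 - 2) + (n - m - 2) = n - 5"
    using assms by simp
  then have middle: "real (peak_count {2} (m - 1)) * real (peak_count {2} (n - m)) =
      (real m - 3) * (real n - real m - 2) * e"
    using assms by (simp add: peak_count_2 e_def power_add[symmetric])
  have "real (peak_count {2, m, n - 1} n) = ?rhs * e"
    using assms unfolding peak_count_2_single_penultimate[OF assms] of_nat_add of_nat_mult
      left right middle
    by (simp add: algebra_simps)
  moreover have "(2::real) ^ (n - 4) = 2 * e"
    using assms by (simp add: e_def flip: power_Suc)
  ultimately show ?thesis
    by (simp add: peak_p_def e_def flip: peak_count_def)
qed

section \<open>Unimodality\<close>

definition binomial_weight :: "nat \<Rightarrow> nat \<Rightarrow> real" where
  "binomial_weight m n = 2 * real n * ((real m - 1) * (real n - real m)) - 4 * (real n - 2)\<^sup>2"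

lemma peak_p_closed_form:
  assumes "4 \<le> m" "m + 3 \<le> n"
  shows "(real n - 2) * (2 * peak_p m n) =
    real ((n - 1) choose (m - 1)) * binomial_weight m n
      - 2 * (real n - 1) * (real n - 2) * (real n - 4)"
proof -
  obtain r where m_eq: "m = r + 4"
    using assms by (intro that[of "m - 4"]) auto
  obtain N where n_eq: "n = N + 4"
    using assms by (intro that[of "n - 4"]) auto
  define x y z w where "x = real (N choose (r + 3))" and "y = real (N choose (r + 2))"
    and "z = real (N choose (r + 1))" and "w = real (N choose r)"
  note binomials = x_def y_def z_def w_def
  have "(real r + 3) * x = (real N - real r - 2) * y"
    "(real r + 2) * y = (real N - real r - 1) * z" "(real r + 1) * z = (real N - real r) * w"
    using of_nat_Suc_times_binomial[of "r + 2" N] of_nat_Suc_times_binomial[of "r + 1" N]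
      of_nat_Suc_times_binomial[of r N]
    by (simp_all add: binomials algebra_simps numeral_eq_Suc)
  moreover have "real (n - 1 choose (m - 1)) = x + 3 * y + 3 * z + w"
    by (simp add: binomials m_eq n_eq numeral_eq_Suc)
  moreover have "real (n - 4 choose (m - 1)) = x" "real (n - 4 choose (m - 2)) = y"
    "real (n - 4 choose (m - 3)) = z" "real (n - 4 choose (m - 4)) = w"
    by (simp_all add: binomials m_eq n_eq numeral_eq_Suc)
  ultimately show ?thesis
    unfolding two_peak_p_eq[OF assms] binomial_weight_def by (simp add: m_eq n_eq) algebra
qed

lemma binomial_weight_pos:
  assumes "4 \<le> m" "m + 3 \<le> n"
  shows "0 < binomial_weight m n"
proof -
  have n_ge_7: "7 \<le> real n"
    using assms by simp
  have "0 \<le> (real m - 4) * (real n - 3 - real m)"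
    using assms by (intro mult_nonneg_nonneg) auto
  then have "3 * (real n - 4) \<le> (real m - 1) * (real n - real m)"
    by (simp add: algebra_simps)
  then have "2 * real n * (3 * (real n - 4)) \<le> 2 * real n * ((real m - 1) * (real n - real m))"
    by (intro mult_left_mono) auto
  moreover have "2 * real n * (3 * (real n - 4)) - 4 * (real n - 2)\<^sup>2 =
      2 * ((real n - 7) * real n) + (6 * real n - 16)"
    by (simp add: algebra_simps power2_eq_square)
  moreover have "0 \<le> (real n - 7) * real n"
    using n_ge_7 by (intro mult_nonneg_nonneg) auto
  ultimately show ?thesis
    using n_ge_7 unfolding binomial_weight_def by linarith
qed

lemma binomial_weight_mono:
  assumes "i \<le> j" "i + j \<le> n + 1"
  shows "binomial_weight i n \<le> binomial_weight j n"
proof -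
  have "0 \<le> (real j - real i) * (real n + 1 - real i - real j)"
    using assms by (intro mult_nonneg_nonneg) auto
  then have "(real i - 1) * (real n - real i) \<le> (real j - 1) * (real n - real j)"
    by (simp add: algebra_simps)
  then show ?thesis
    using mult_left_mono[of _ _ "2 * real n"] by (simp add: binomial_weight_def)
qed

lemma strict_mono_on_peak_p:
  assumes "7 \<le> n"
  shows "strict_mono_on {4..(n + 1) div 2} (\<lambda>m. peak_p m n)"
proof (rule strict_mono_onI)
  fix i j assume in_range: "i \<in> {4..(n + 1) div 2}" "j \<in> {4..(n + 1) div 2}" "i < j"
  then have bounds: "4 \<le> i" "i + 3 \<le> n" "4 \<le> j" "j + 3 \<le> n" "i + j \<le> n + 1"
    using assms by auto
  have "n - 1 choose (i - 1) < n - 1 choose (j - 1)"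
    using in_range by (intro binomial_strict_mono) auto
  then have "real (n - 1 choose (i - 1)) * binomial_weight i n <
      real (n - 1 choose (j - 1)) * binomial_weight i n"
    using binomial_weight_pos bounds by simp
  also have "\<dots> \<le> real (n - 1 choose (j - 1)) * binomial_weight j n"
    using in_range bounds by (intro mult_left_mono binomial_weight_mono) auto
  finally have "(real n - 2) * (2 * peak_p i n) < (real n - 2) * (2 * peak_p j n)"
    using bounds by (simp add: peak_p_closed_form)
  then show "peak_p i n < peak_p j n"
    using assms by simp
qed

context
  fixes f :: "nat \<Rightarrow> real" and a b :: nat
  assumes a_le_b: "a \<le> b"
    and sym: "\<And>m. m \<in> {a..b} \<Longrightarrow> f (a + b - m) = f m"
    and mono: "strict_mono_on {a..(a + b) div 2} f"
begin

lemma symmetric_le_iff: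
  assumes "i \<in> {a..b}" "j \<in> {a..b}"
  shows "f i \<le> f j \<longleftrightarrow> min i (a + b - i) \<le> min j (a + b - j)"
proof -
  have "min m (a + b - m) \<in> {a..(a + b) div 2}" "f (min m (a + b - m)) = f m"
    if "m \<in> {a..b}" for m
    using that sym by (auto simp: min_def)
  then show ?thesis
    using strict_mono_on_less_eq[OF mono] assms by metis
qed

lemma unimodal_on_symmetric: "unimodal_on {a..b} f"
proof -
  have "(a + b) div 2 \<in> {a..b}"
    using a_le_b by auto
  then show ?thesis
    unfolding unimodal_on_def by (intro bexI[of _ "(a + b) div 2"]) (auto simp: symmetric_le_iff)
qed

lemma argmax_symmetric:
  "{m \<in> {a..b}. \<forall>k\<in>{a..b}. f k \<le> f m} = {(a + b) div 2, (a + b + 1) div 2}"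
proof -
  let ?c = "(a + b) div 2" and ?d = "(a + b + 1) div 2"
  have halves_mem: "?c \<in> {a..b}" "?d \<in> {a..b}"
    using a_le_b by (simp_all, linarith+)
  define folded where "folded k = min k (a + b - k)" for k
  have folded_le: "folded k \<le> ?c" for k
    unfolding folded_def by linarith
  have folded_half: "folded ?c = ?c"
    unfolding folded_def by linarith
  have max: "(\<forall>k\<in>{a..b}. f k \<le> f m) \<longleftrightarrow> m = ?c \<or> m = ?d" if "m \<in> {a..b}" for m
  proof -
    have "(\<forall>k\<in>{a..b}. f k \<le> f m) \<longleftrightarrow> (\<forall>k\<in>{a..b}. folded k \<le> folded m)"
      using that by (simp add: symmetric_le_iff folded_def)
    also have "\<dots> \<longleftrightarrow> ?c \<le> folded m"
      using halves_mem(1) folded_le folded_half by (metis order_trans)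
    also have "\<dots> \<longleftrightarrow> ?c \<le> m \<and> ?c \<le> a + b - m"
      by (simp add: folded_def)
    also have "\<dots> \<longleftrightarrow> ?c \<le> m \<and> m \<le> ?d"
      using that by auto
    also have "\<dots> \<longleftrightarrow> m = ?c \<or> m = ?d"
      by arith
    finally show ?thesis .
  qed
  show ?thesis
  proof (rule set_eqI)
    show "m \<in> {m \<in> {a..b}. \<forall>k\<in>{a..b}. f k \<le> f m} \<longleftrightarrow> m \<in> {?c, ?d}" for m
      using max[of m] halves_mem by blast
  qed
qed

end

lemma nat_floor_half: "nat \<lfloor>real k / 2\<rfloor> = k div 2"
  using floor_divide_of_nat_eq[of k 2, where ?'a = real] by simp

lemma nat_ceiling_half: "nat \<lceil>real k / 2\<rceil> = (k + 1) div 2"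
proof -
  have "\<lceil>real k / 2\<rceil> = - (- int k div 2)"
    using ceiling_divide_eq_div[of "int k" 2] by simp
  then show ?thesis
    by linarith
qed

theorem theorem4p3:
  fixes n :: nat
  assumes "7 \<le> n"
  shows "(\<forall>m. 4 \<le> m \<and> m \<le> n - 3 \<longrightarrow>
            2 * peak_p m n =
              (real m - 3) * (real n - real m - 2) * real ((n - 1) choose (m - 1)) +
              (real n - 1) *
                ((real m - 3) * real ((n - 4) choose (m - 1)) +
                 (real m - 2) * real ((n - 4) choose (m - 2)) +
                 (real n - real m - 1) * real ((n - 4) choose (m - 3)) +
                 (real n - real m - 2) * real ((n - 4) choose (m - 4)) -
                 2 * real ((n - 4) choose 1))) \<and>
         (\<forall>m. 4 \<le> m \<and> m \<le> n - 3 \<longrightarrow> peak_p m n = peak_p (n + 1 - m) n) \<and>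
         unimodal_on {4..n - 3} (\<lambda>m. peak_p m n) \<and>
         {m \<in> {4..n - 3}. \<forall>k\<in>{4..n - 3}. peak_p k n \<le> peak_p m n} =
           {nat \<lfloor>(real n + 1) / 2\<rfloor>, nat \<lceil>(real n + 1) / 2\<rceil>}"
proof -
  have ends: "4 \<le> n - 3" "4 + (n - 3) = n + 1"
    using assms by auto
  have sym: "peak_p (4 + (n - 3) - m) n = peak_p m n" if "m \<in> {4..n - 3}" for m
    using that peak_p_symmetric ends by simp
  have mono: "strict_mono_on {4..(4 + (n - 3)) div 2} (\<lambda>m. peak_p m n)"
    using strict_mono_on_peak_p[OF assms] by (simp add: ends)
  have "{m \<in> {4..n - 3}. \<forall>k\<in>{4..n - 3}. peak_p k n \<le> peak_p m n} =
      {nat \<lfloor>(real n + 1) / 2\<rfloor>, nat \<lceil>(real n + 1) / 2\<rceil>}"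
    using argmax_symmetric[where f = "\<lambda>m. peak_p m n", OF ends(1) sym mono]
      nat_floor_half[of "n + 1"] nat_ceiling_half[of "n + 1"]
    by (simp add: ends add.commute)
  moreover have "m + 3 \<le> n" if "m \<le> n - 3" for m
    using that assms by simp
  moreover note unimodal_on_symmetric[where f = "\<lambda>m. peak_p m n", OF ends(1) sym mono]
  ultimately show ?thesis
    by (intro conjI allI impI) (use two_peak_p_eq peak_p_symmetric[symmetric] in blast)+
qed

end
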